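(* Let $G$ be a finite abelian group of odd order, let $S \subseteq G$ be a symmetric subset (i.e.\ $-s \in S$ for all $s \in S$), and let $X = \operatorname{Cay}(G;S)$. Suppose $X$ is connected and twin-free. Then $\operatorname{Aut}(BX) = \operatorname{Aut} X \times S_2$; that is, every automorphism of $BX$ is of the form $(v,i) \mapsto (\alpha(v), \sigma(i))$ for some $\alpha \in \operatorname{Aut} X$ and some permutation $\sigma$ of $\{0,1\}$.
   Context: Graphs are undirected, without multiple edges; loops are allowed. For an abelian group $G$ and a symmetric subset $S$, the Cayley graph $\operatorname{Cay}(G;S)$ has vertex set $G$, with $g$ and $h$ adjacent iff $g = s + h$ for some $s \in S$. A graph $X$ is twin-free if there are no two distinct vertices $v,w$ with $N_X(v) = N_X(w)$, where $N_X(v)$ is the set of neighbours of $v$. The canonical bipartite double cover $BX$ of $X$ has vertex set $V(X) \times \{0,1\}$, with $(v,0)$ adjacent to $(w,1)$ iff $v$ is adjacent to $w$ in $X$ (and no other edges). $S_2$ denotes the symmetric group on $\{0,1\}$, and $\operatorname{Aut} X \times S_2$ is regarded as a subgroup of $\operatorname{Aut}(BX)$ via $(\alpha,\sigma)\cdot(v,i) = (\alpha(v),\sigma(i))$. *)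

theory Defs
  imports "Graph_Theory.Graph_Theory" "HOL-Algebra.Bij" "HOL-Algebra.Coset"
begin

text \<open>An undirected graph without multiple edges, possibly with loops, is a symmetric
  \<^typ>\<open>'a pair_pre_digraph\<close> (locale \<^locale>\<open>pair_sym_digraph\<close>): the edge joining
  \<open>v\<close> and \<open>w\<close> is the pair of arcs \<open>(v, w)\<close>, \<open>(w, v)\<close>.\<close>

definition nbrs :: "'a pair_pre_digraph \<Rightarrow> 'a \<Rightarrow> 'a set" where
  "nbrs X v = {w \<in> pverts X. (v, w) \<in> parcs X}"

definition twin_free :: "'a pair_pre_digraph \<Rightarrow> bool" where
  "twin_free X \<longleftrightarrow>
     \<not> (\<exists>v \<in> pverts X. \<exists>w \<in> pverts X. v \<noteq> w \<and> nbrs X v = nbrs X w)"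

text \<open>As in \<^const>\<open>Bij\<close>, a permutation of the vertex set is extended by \<^const>\<open>undefined\<close>
  outside of it, so that equality in \<open>graph_aut\<close> is equality of maps on vertices.\<close>

definition graph_aut :: "'a pair_pre_digraph \<Rightarrow> ('a \<Rightarrow> 'a) set" where
  "graph_aut X = {f \<in> Bij (pverts X).
     \<forall>v \<in> pverts X. \<forall>w \<in> pverts X. (f v, f w) \<in> parcs X \<longleftrightarrow> (v, w) \<in> parcs X}"

text \<open>The abelian groups of the source are additive; here \<open>g = s + h\<close> reads \<open>g = s \<otimes> h\<close>.\<close>

definition Cay :: "('a, 'm) monoid_scheme \<Rightarrow> 'a set \<Rightarrow> 'a pair_pre_digraph" where
  "Cay G S = \<lparr> pverts = carrier G,
     parcs = {(g, h). g \<in> carrier G \<and> h \<in> carrier G \<and> (\<exists>s \<in> S. g = s \<otimes>\<^bsub>G\<^esub> h)} \<rparr>"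

definition bip_double :: "'a pair_pre_digraph \<Rightarrow> ('a \<times> nat) pair_pre_digraph" where
  "bip_double X = \<lparr> pverts = pverts X \<times> {0, 1},
     parcs = {((v, 0), (w, 1)) | v w. (v, w) \<in> parcs X}
           \<union> {((w, 1), (v, 0)) | v w. (v, w) \<in> parcs X} \<rparr>"

text \<open>The action of \<open>(\<alpha>, \<sigma>)\<close> on \<open>V \<times> {0, 1}\<close>.\<close>

definition prod_act :: "'a set \<Rightarrow> ('a \<Rightarrow> 'a) \<times> (nat \<Rightarrow> nat) \<Rightarrow> 'a \<times> nat \<Rightarrow> 'a \<times> nat" where
  "prod_act V = (\<lambda>(\<alpha>, \<sigma>). \<lambda>(v, i) \<in> V \<times> {0, 1}. (\<alpha> v, \<sigma> i))"

definition aut_times_S2 :: "'a pair_pre_digraph \<Rightarrow> ('a \<times> nat \<Rightarrow> 'a \<times> nat) set" where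
  "aut_times_S2 X = prod_act (pverts X) ` (graph_aut X \<times> Bij {0, 1})"

lemma pair_sym_digraph_Cay:
  assumes "comm_group G" "S \<subseteq> carrier G" "\<And>s. s \<in> S \<Longrightarrow> inv\<^bsub>G\<^esub> s \<in> S"
  shows "pair_sym_digraph (Cay G S)"
proof -
  interpret comm_group G by fact
  have "(h, g) \<in> parcs (Cay G S)" if "(g, h) \<in> parcs (Cay G S)" for g h
  proof -
    from that obtain s where s: "s \<in> S" "g = s \<otimes>\<^bsub>G\<^esub> h" and gh: "g \<in> carrier G" "h \<in> carrier G"
      by (auto simp: Cay_def)
    then have "h = inv\<^bsub>G\<^esub> s \<otimes>\<^bsub>G\<^esub> g"
      using assms(2) by (auto simp: m_assoc[symmetric])
    then show ?thesis using s gh assms(3) by (auto simp: Cay_def)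
  qed
  then show ?thesis
    by unfold_locales (auto simp: Cay_def symmetric_def sym_def arcs_ends_conv)
qed

lemma pair_sym_digraph_bip_double:
  assumes "pair_sym_digraph X"
  shows "pair_sym_digraph (bip_double X)"
proof -
  interpret pair_sym_digraph X by fact
  show ?thesis
    by unfold_locales
      (auto simp: bip_double_def symmetric_def sym_def arcs_ends_conv
        dest: arc_fst_in_verts arc_snd_in_verts)
qed

end

theory Submission
  imports Defs "HOL-Number_Theory.Residues" "HOL-Library.Z2"
begin

text \<open>For \<open>x, y \<in> G\<close> the involution \<open>z \<mapsto> x y z\<inverse>\<close> acts on the walks \<open>x, z, y\<close> of length two in
  \<open>Cay(G; S)\<close>. It fixes \<open>z\<close> iff \<open>x = s\<^sup>2 y\<close> with \<open>s = x z\<inverse>\<close>, and \<open>s\<close> is determined by its square as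
  \<open>|G|\<close> is odd. Hence the parity of the number of such walks recovers
  \<open>Cay(G; {s\<^sup>2 | s \<in> S})\<close> from \<open>Cay(G; S)\<close>. An automorphism of \<open>BX\<close> cannot separate \<open>(x, i)\<close>
  from \<open>(s\<^sup>2 x, i)\<close>, hence, as \<open>s\<close> is a power of \<open>s\<^sup>2\<close> and \<open>X\<close> is connected, it maps each side of
  \<open>BX\<close> into one side. So up to swapping the sides it is a pair \<open>(f, g)\<close> of permutations of \<open>G\<close>, and counting walks of length two in \<open>BX\<close> shows that
  \<open>f\<close> and \<open>g\<close> are both automorphisms of \<open>Cay(G; {s\<^sup>2})\<close>. Squaring repeatedly, they are
  automorphisms of \<open>Cay(G; {s\<^bsup>2^k\<^esup>})\<close> for all \<open>k \<ge> 1\<close>, and this is \<open>X\<close> itself when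
  \<open>2\<^sup>k \<equiv> 1\<close> modulo \<open>|G|\<close>. Then \<open>f x\<close> and \<open>g x\<close> have the same neighbours, so \<open>f = g\<close>.\<close>

section \<open>Involutions, parity and bijections\<close>

lemma even_card_fixpoint_free_involution:
  assumes "\<And>x. x \<in> A \<Longrightarrow> h x \<in> A" "\<And>x. x \<in> A \<Longrightarrow> h (h x) = x" "\<And>x. x \<in> A \<Longrightarrow> h x \<noteq> x"
  shows "even (card A)"
proof -
  \<comment> \<open>In the field \<open>bit\<close>, where 1 + 1 = 0, the terms at \<open>x\<close>
    and \<open>h x\<close> cancel. An infinite \<open>A\<close> causes no trouble, its
    \<open>card\<close> being 0.\<close>
  have "(\<Sum>x\<in>A. 1 :: bit) = 0"
    by (rule sum_involution_eq_0[where h = h]) (use assms in auto)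
  then have "(of_nat (card A) :: bit) = 0" by simp
  then show ?thesis by (cases "even (card A)") (auto elim!: oddE)
qed

text \<open>The points moved by \<open>h\<close> pair off, so modulo 2 only the fixed points
  count.\<close>

lemma odd_card_involution_iff:
  assumes "finite A" "\<And>x. x \<in> A \<Longrightarrow> h x \<in> A" "\<And>x. x \<in> A \<Longrightarrow> h (h x) = x"
  shows "odd (card A) \<longleftrightarrow> odd (card {x \<in> A. h x = x})"
proof -
  have "even (card {x \<in> A. h x \<noteq> x})"
    by (rule even_card_fixpoint_free_involution[where h = h]) (use assms in auto)
  moreover have "card A = card {x \<in> A. h x = x} + card {x \<in> A. h x \<noteq> x}"
    using assms(1) by (subst card_Un_disjoint[symmetric]) (auto intro: arg_cong[where f = card])
  ultimately show ?thesis by simp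
qed

lemma bij_betw_image_Collect:
  assumes f: "bij_betw f V W" and PQ: "\<And>v. v \<in> V \<Longrightarrow> Q (f v) \<longleftrightarrow> P v"
  shows "f ` {v \<in> V. P v} = {w \<in> W. Q w}"
proof -
  have "W = f ` V" using f by (simp add: bij_betw_def)
  then show ?thesis using PQ by auto
qed

section \<open>Cayley graphs and squared connection sets\<close>

lemma parcs_Cay_iff:
  "(g, h) \<in> parcs (Cay G S) \<longleftrightarrow>
     g \<in> carrier G \<and> h \<in> carrier G \<and> (\<exists>s \<in> S. g = s \<otimes>\<^bsub>G\<^esub> h)"
  by (simp add: Cay_def)

lemma pverts_Cay [simp]: "pverts (Cay G S) = carrier G"
  by (simp add: Cay_def)

lemma (in group) parcs_Cay_iff_quotient:
  assumes "S \<subseteq> carrier G" "x \<in> carrier G" "y \<in> carrier G"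
  shows "(x, y) \<in> parcs (Cay G S) \<longleftrightarrow> x \<otimes> inv y \<in> S"
proof -
  have "x \<otimes> inv y = s \<longleftrightarrow> x = s \<otimes> y" if "s \<in> S" for s
    using assms that by (metis inv_solve_right' subsetD)
  then show ?thesis using assms unfolding parcs_Cay_iff by metis
qed

text \<open>If the order is \<open>2 * k + 1\<close>, raising to the power \<open>k + 1\<close>
  undoes squaring, by Lagrange.\<close>

lemma (in group) inj_on_square:
  assumes "odd (order G)"
  shows "inj_on (\<lambda>x. x \<otimes> x) (carrier G)"
proof (rule inj_onI)
  obtain k where k: "order G = 2 * k + 1" using assms by (elim oddE)
  have root: "(x \<otimes> x) [^] (k + 1) = x" if "x \<in> carrier G" for x
  proof -
    have "(x \<otimes> x) [^] (k + 1) = (x [^] (2::nat)) [^] (k + 1)"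
      using that by (simp add: numeral_2_eq_2)
    also have "\<dots> = x [^] (order G + 1)"
      using that by (simp only: nat_pow_pow k) (simp add: algebra_simps)
    also have "\<dots> = x"
      using that by (simp add: pow_order_eq_1)
    finally show ?thesis .
  qed
  fix x y
  assume "x \<in> carrier G" "y \<in> carrier G" "x \<otimes> x = y \<otimes> y"
  then show "x = y" using root by metis
qed

lemma (in comm_group) parcs_Cay_squares_iff:
  assumes "finite (carrier G)" "odd (order G)" "S \<subseteq> carrier G"
    and "x \<in> carrier G" "y \<in> carrier G"
  shows "(x, y) \<in> parcs (Cay G ((\<lambda>s. s \<otimes> s) ` S)) \<longleftrightarrow>
     odd (card {z \<in> carrier G. (x, z) \<in> parcs (Cay G S) \<and> (z, y) \<in> parcs (Cay G S)})"
    (is "?E \<longleftrightarrow> odd (card ?Z)")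
proof -
  \<comment> \<open>By commutativity, passing from \<open>z\<close> to \<open>?h z\<close>
    interchanges the two steps \<open>x \<otimes> inv z\<close> and \<open>z \<otimes> inv y\<close>
    of the walk.\<close>
  let ?h = "\<lambda>z. x \<otimes> y \<otimes> inv z"
  have Z: "z \<in> ?Z \<longleftrightarrow> z \<in> carrier G \<and> x \<otimes> inv z \<in> S \<and> z \<otimes> inv y \<in> S" for z
    using assms by (auto simp: parcs_Cay_iff_quotient)
  have h1: "x \<otimes> inv (?h z) = z \<otimes> inv y" "?h z \<otimes> inv y = x \<otimes> inv z" "?h (?h z) = z"
    if z: "z \<in> carrier G" for z
  proof -
    have "?h z \<otimes> inv y = x \<otimes> inv z \<otimes> (y \<otimes> inv y)"
      using assms(4,5) z by (simp only: m_ac m_closed inv_closed)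
    then show "?h z \<otimes> inv y = x \<otimes> inv z"
      using assms(4,5) z by simp
    have "x \<otimes> inv (?h z) = (x \<otimes> inv x) \<otimes> (z \<otimes> inv y)"
      using assms(4,5) z by (simp only: inv_mult inv_inv m_ac m_closed inv_closed)
    then show *: "x \<otimes> inv (?h z) = z \<otimes> inv y"
      using assms(4,5) z by simp
    have "?h (?h z) = x \<otimes> inv (?h z) \<otimes> y"
      using assms(4,5) z by (simp only: m_ac m_closed inv_closed)
    also have "\<dots> = z"
      using assms(4,5) z by (simp only: *) (simp add: m_assoc)
    finally show "?h (?h z) = z" .
  qed
  have fixed: "?h z = z \<longleftrightarrow> x \<otimes> inv z = z \<otimes> inv y" if z: "z \<in> carrier G" for z
  proof -
    have "?h z = z \<longleftrightarrow> ?h z \<otimes> inv y = z \<otimes> inv y"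
      using assms(4,5) z by (subst right_cancel) auto
    then show ?thesis by (simp only: h1(2)[OF z])
  qed
  have odd_iff: "odd (card ?Z) \<longleftrightarrow> odd (card {z \<in> ?Z. ?h z = z})"
  proof (rule odd_card_involution_iff)
    show "finite ?Z" using assms(1) by simp
    show "?h z \<in> ?Z" if "z \<in> ?Z" for z
      using that assms h1[of z] unfolding Z by simp
    show "?h (?h z) = z" if "z \<in> ?Z" for z
      using that h1(3) by simp
  qed
  \<comment> \<open>At a fixed point both steps of the walk coincide, and their common value is a
    square root of \<open>x \<otimes> inv y\<close> lying in \<open>S\<close>.\<close>
  have bij: "bij_betw (\<lambda>z. z \<otimes> inv y) {z \<in> ?Z. ?h z = z} {s \<in> S. s \<otimes> s = x \<otimes> inv y}"
  proof (rule bij_betw_byWitness[where f' = "\<lambda>s. s \<otimes> y"])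
    show "\<forall>z\<in>{z \<in> ?Z. ?h z = z}. z \<otimes> inv y \<otimes> y = z"
      using assms by (auto simp: m_assoc)
    show "\<forall>s\<in>{s \<in> S. s \<otimes> s = x \<otimes> inv y}. s \<otimes> y \<otimes> inv y = s"
      using assms by (auto simp: m_assoc)
    show "(\<lambda>z. z \<otimes> inv y) ` {z \<in> ?Z. ?h z = z} \<subseteq> {s \<in> S. s \<otimes> s = x \<otimes> inv y}"
    proof (rule image_subsetI)
      fix z assume "z \<in> {z \<in> ?Z. ?h z = z}"
      then have z: "z \<in> ?Z" "?h z = z" by blast+
      then have zc: "z \<in> carrier G" and zS: "z \<otimes> inv y \<in> S" by (simp_all only: Z)
      have "(z \<otimes> inv y) \<otimes> (z \<otimes> inv y) = (x \<otimes> inv z) \<otimes> (z \<otimes> inv y)"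
        using z fixed[OF zc] by simp
      also have "\<dots> = x \<otimes> inv y"
        using assms(4,5) zc by (metis inv_closed l_inv l_one m_assoc m_closed)
      finally show "z \<otimes> inv y \<in> {s \<in> S. s \<otimes> s = x \<otimes> inv y}"
        using zS by simp
    qed
    show "(\<lambda>s. s \<otimes> y) ` {s \<in> S. s \<otimes> s = x \<otimes> inv y} \<subseteq> {z \<in> ?Z. ?h z = z}"
    proof (rule image_subsetI)
      fix s assume "s \<in> {s \<in> S. s \<otimes> s = x \<otimes> inv y}"
      then have s: "s \<in> S" "s \<otimes> s = x \<otimes> inv y" by blast+
      then have sc: "s \<in> carrier G" using assms by auto
      have sy: "s \<otimes> y \<otimes> inv y = s" using sc assms by (simp add: m_assoc)
      have "s \<otimes> s \<otimes> y = x" using s(2) sc assms by (simp add: m_assoc)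
      then have "x \<otimes> inv (s \<otimes> y) = s"
        using sc assms(4,5) inv_solve_right'[of s x "s \<otimes> y"] by (simp add: m_assoc)
      then have "s \<otimes> y \<in> ?Z" "?h (s \<otimes> y) = s \<otimes> y"
        using s sc sy assms(4,5) fixed[of "s \<otimes> y"] unfolding Z by simp_all
      then show "s \<otimes> y \<in> {z \<in> ?Z. ?h z = z}" by blast
    qed
  qed
  have "?E \<longleftrightarrow> {s \<in> S. s \<otimes> s = x \<otimes> inv y} \<noteq> {}"
    by (subst parcs_Cay_iff_quotient) (use assms in \<open>auto simp: image_iff eq_commute\<close>)
  \<comment> \<open>Squaring is injective, so there is at most one root, and being nonempty is the
    same as having odd size.\<close>
  also have "\<dots> \<longleftrightarrow> odd (card {s \<in> S. s \<otimes> s = x \<otimes> inv y})"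
  proof
    assume "{s \<in> S. s \<otimes> s = x \<otimes> inv y} \<noteq> {}"
    then obtain s where s: "s \<in> S" "s \<otimes> s = x \<otimes> inv y" by blast
    have "t = s" if "t \<in> S" "t \<otimes> t = x \<otimes> inv y" for t
      using that s assms(3) inj_onD[OF inj_on_square[OF assms(2)], of t s] by auto
    then have "{s \<in> S. s \<otimes> s = x \<otimes> inv y} = {s}" using s by blast
    then show "odd (card {s \<in> S. s \<otimes> s = x \<otimes> inv y})" by simp
  next
    assume "odd (card {s \<in> S. s \<otimes> s = x \<otimes> inv y})"
    then show "{s \<in> S. s \<otimes> s = x \<otimes> inv y} \<noteq> {}" by (metis card.empty even_zero)
  qed
  also have "\<dots> \<longleftrightarrow> odd (card ?Z)"
    unfolding odd_iff bij_betw_same_card[OF bij] ..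
  finally show ?thesis .
qed

text \<open>\<open>g\<close> carries the midpoints of the walks of length two from \<open>x\<close>
  to \<open>y\<close> bijectively onto those from \<open>f x\<close> to \<open>f y\<close>, so the
  parities agree. Two maps occur because in the double cover the midpoint lies on the other side
  from the ends.\<close>

lemma (in comm_group) Cay_squares_preserved:
  assumes "finite (carrier G)" "odd (order G)" "S \<subseteq> carrier G"
    and f: "f \<in> carrier G \<rightarrow> carrier G" and g: "bij_betw g (carrier G) (carrier G)"
    and fg: "\<And>x y. x \<in> carrier G \<Longrightarrow> y \<in> carrier G \<Longrightarrow>
      (f x, g y) \<in> parcs (Cay G S) \<longleftrightarrow> (x, y) \<in> parcs (Cay G S)"
    and gf: "\<And>x y. x \<in> carrier G \<Longrightarrow> y \<in> carrier G \<Longrightarrow>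
      (g x, f y) \<in> parcs (Cay G S) \<longleftrightarrow> (x, y) \<in> parcs (Cay G S)"
    and xy: "x \<in> carrier G" "y \<in> carrier G"
  shows "(f x, f y) \<in> parcs (Cay G ((\<lambda>s. s \<otimes> s) ` S)) \<longleftrightarrow>
    (x, y) \<in> parcs (Cay G ((\<lambda>s. s \<otimes> s) ` S))"
proof -
  let ?Z = "\<lambda>x y. {z \<in> carrier G. (x, z) \<in> parcs (Cay G S) \<and> (z, y) \<in> parcs (Cay G S)}"
  have img: "g ` ?Z x y = ?Z (f x) (f y)"
    using fg[OF xy(1)] gf[OF _ xy(2)] by (intro bij_betw_image_Collect[OF g]) simp
  have "inj_on g (?Z x y)"
    by (rule inj_on_subset[OF bij_betw_imp_inj_on[OF g]]) blast
  then have "card (?Z (f x) (f y)) = card (?Z x y)"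
    unfolding img[symmetric] by (rule card_image)
  moreover have fc: "f x \<in> carrier G" "f y \<in> carrier G" using f xy by auto
  ultimately show ?thesis
    by (simp only: parcs_Cay_squares_iff[OF assms(1-3)] xy fc)
qed

text \<open>Squaring the connection set over and over leads back to \<open>S\<close>, since 2 is
  invertible modulo the odd group order; each squaring keeps \<open>f\<close> an
  automorphism.\<close>

lemma (in comm_group) Cay_automorphism_of_squares:
  assumes fin: "finite (carrier G)" and odd: "odd (order G)" and S: "S \<subseteq> carrier G"
    and f: "bij_betw f (carrier G) (carrier G)"
    and sq: "\<And>x y. x \<in> carrier G \<Longrightarrow> y \<in> carrier G \<Longrightarrow>
      (f x, f y) \<in> parcs (Cay G ((\<lambda>s. s \<otimes> s) ` S)) \<longleftrightarrow>
      (x, y) \<in> parcs (Cay G ((\<lambda>s. s \<otimes> s) ` S))"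
    and xy: "x \<in> carrier G" "y \<in> carrier G"
  shows "(f x, f y) \<in> parcs (Cay G S) \<longleftrightarrow> (x, y) \<in> parcs (Cay G S)"
proof -
  let ?T = "\<lambda>k. (\<lambda>s. s [^] ((2::nat) ^ k)) ` S"
  have sq_eq: "(\<lambda>s. s \<otimes> s) ` ?T k = ?T (Suc k)" for k
  proof -
    have "s [^] ((2::nat) ^ k) \<otimes> s [^] ((2::nat) ^ k) = s [^] ((2::nat) ^ Suc k)" if "s \<in> S" for s
      using that S by (auto simp: nat_pow_mult mult_2)
    then show ?thesis by (auto simp: image_image)
  qed
  \<comment> \<open>The exponents start at \<open>2 ^ 1\<close>, because the hypothesis concerns the
    squares and says nothing yet about \<open>?T 0 = S\<close>. In the induction \<open>f\<close>
    moves both ends and midpoints.\<close>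
  have iter: "\<forall>x \<in> carrier G. \<forall>y \<in> carrier G.
      (f x, f y) \<in> parcs (Cay G (?T (Suc k))) \<longleftrightarrow> (x, y) \<in> parcs (Cay G (?T (Suc k)))" for k
  proof (induction k)
    case 0
    have "?T 0 = S" 
      by (rule trans[OF image_cong[OF refl] image_ident]) (use S in auto)
    then show ?case using sq sq_eq[of 0] by simp
  next
    case (Suc k)
    have "?T (Suc k) \<subseteq> carrier G" using S by auto
    then show ?case
      unfolding sq_eq[of "Suc k", symmetric]
      using Cay_squares_preserved[OF fin odd, of "?T (Suc k)" f f] f Suc bij_betwE[OF f]
      by blast
  qed
  have "order G > 0" using odd odd_pos by blast
  \<comment> \<open>Euler's theorem makes 2 to the power \<open>totient (order G)\<close> congruent
    to 1; a positive exponent is written \<open>Suc k\<close> to fit \<open>iter\<close>.\<close>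
  then obtain k where k: "totient (order G) = Suc k" by (metis gr0_implies_Suc totient_gt_0_iff)
  have "s [^] ((2::nat) ^ Suc k) = s" if "s \<in> S" for s
  proof -
    have "[2 ^ Suc k = 1] (mod (order G))"
      using euler_theorem[of 2 "order G"] odd k by simp
    then obtain q where "2 ^ Suc k - 1 = order G * q"
      by (metis cong_to_1_nat dvdE)
    then have q: "2 ^ Suc k = 1 + order G * q"
      by (metis le_add_diff_inverse one_le_numeral one_le_power)
    have sc: "s \<in> carrier G" using that S by auto
    then have "s [^] (1 + order G * q) = s \<otimes> (s [^] order G) [^] q"
      by (simp add: nat_pow_mult[symmetric] nat_pow_pow m_comm)
    then show ?thesis using sc unfolding q by (simp add: pow_order_eq_1)
  qed
  then have "?T (Suc k) = S" by simp
  then show ?thesis using iter[of k] xy by simp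
qed

section \<open>Neighbourhoods and connectedness in Cayley graphs\<close>

lemma nbrs_image:
  assumes f: "bij_betw f (pverts X) (pverts X)"
    and hf: "\<And>w. w \<in> pverts X \<Longrightarrow> (u, f w) \<in> parcs X \<longleftrightarrow> (v, w) \<in> parcs X"
  shows "nbrs X u = f ` nbrs X v"
  unfolding nbrs_def by (rule bij_betw_image_Collect[OF f, symmetric]) (simp add: hf)

text \<open>\<open>f\<close> and \<open>g\<close> stand for the actions of an automorphism of the
  double cover on its two sides. Once \<open>f\<close> alone preserves arcs, \<open>f x\<close> and
  \<open>g x\<close> share a neighbourhood, the image under \<open>f\<close> of that of
  \<open>x\<close>, and twin-freeness identifies them.\<close>

lemma (in comm_group) Cay_twin_free_side_maps_eq:
  assumes fin: "finite (carrier G)" and odd: "odd (order G)" and S: "S \<subseteq> carrier G"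
    and tf: "twin_free (Cay G S)"
    and f: "bij_betw f (carrier G) (carrier G)" and g: "bij_betw g (carrier G) (carrier G)"
    and fg: "\<And>x y. x \<in> carrier G \<Longrightarrow> y \<in> carrier G \<Longrightarrow>
      (f x, g y) \<in> parcs (Cay G S) \<longleftrightarrow> (x, y) \<in> parcs (Cay G S)"
    and gf: "\<And>x y. x \<in> carrier G \<Longrightarrow> y \<in> carrier G \<Longrightarrow>
      (g x, f y) \<in> parcs (Cay G S) \<longleftrightarrow> (x, y) \<in> parcs (Cay G S)"
  shows "\<forall>x \<in> carrier G. f x = g x"
    and "\<forall>x \<in> carrier G. \<forall>y \<in> carrier G.
      (f x, f y) \<in> parcs (Cay G S) \<longleftrightarrow> (x, y) \<in> parcs (Cay G S)"
proof -
  have fc: "f \<in> carrier G \<rightarrow> carrier G" and gc: "g \<in> carrier G \<rightarrow> carrier G"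
    using f g by (auto simp: bij_betw_def)
  show ff: "\<forall>x \<in> carrier G. \<forall>y \<in> carrier G.
      (f x, f y) \<in> parcs (Cay G S) \<longleftrightarrow> (x, y) \<in> parcs (Cay G S)"
    using Cay_automorphism_of_squares[OF fin odd S f
        Cay_squares_preserved[OF fin odd S fc g fg gf]] by blast
  show "\<forall>x \<in> carrier G. f x = g x"
  proof
    fix x assume x: "x \<in> carrier G"
    have "nbrs (Cay G S) (f x) = f ` nbrs (Cay G S) x"
      using f ff x by (intro nbrs_image) auto
    moreover have "nbrs (Cay G S) (g x) = f ` nbrs (Cay G S) x"
      using f gf x by (intro nbrs_image) auto
    ultimately show "f x = g x"
      using tf x bij_betwE[OF f] bij_betwE[OF g] unfolding twin_free_def pverts_Cay by metis
  qed
qed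

text \<open>Each edge of a connecting path is a multiplication by some element of \<open>S\<close>,
  taken forwards or backwards. It will be applied with \<open>F\<close> recording the side to which
  a vertex is sent.\<close>

lemma connected_Cay_const:
  assumes "connected (with_proj (Cay G S))"
    and step: "\<And>s x. s \<in> S \<Longrightarrow> x \<in> carrier G \<Longrightarrow> F (s \<otimes>\<^bsub>G\<^esub> x) = F x"
    and "x \<in> carrier G" "y \<in> carrier G"
  shows "F x = F y"
proof -
  have "(x, y) \<in> rtrancl_on (carrier G) ((parcs (Cay G S))\<^sup>s)"
    using assms by (simp add: connected_conv)
  then show ?thesis
  proof (induction rule: rtrancl_on_induct)
    case (step y z)
    then show ?case
      using assms(2) by (auto simp: symcl_def parcs_Cay_iff)
  qed simp
qed

section \<open>The double cover and its automorphisms\<close>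

lemma pverts_bip_double [simp]: "pverts (bip_double X) = pverts X \<times> {0, 1}"
  by (simp add: bip_double_def)

text \<open>Symmetry of \<open>X\<close> lets one condition cover both halves of the arc set,
  whichever side comes first.\<close>

lemma parcs_bip_double_iff:
  assumes "pair_sym_digraph X"
  shows "((v, i), (w, j)) \<in> parcs (bip_double X) \<longleftrightarrow>
    i \<in> {0, 1} \<and> j \<in> {0, 1} \<and> i \<noteq> j \<and> (v, w) \<in> parcs X"
proof -
  interpret pair_sym_digraph X by fact
  have "(v, w) \<in> parcs X \<longleftrightarrow> (w, v) \<in> parcs X" for v w
    using sym_arcs by (auto simp: symmetric_def sym_def)
  then show ?thesis by (auto simp: bip_double_def)
qed

lemma aut_times_S2_subset:
  assumes X: "pair_sym_digraph X"
  shows "aut_times_S2 X \<subseteq> graph_aut (bip_double X)"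
proof
  fix \<phi> assume "\<phi> \<in> aut_times_S2 X"
  then obtain \<alpha> \<sigma> where \<phi>: "\<phi> = prod_act (pverts X) (\<alpha>, \<sigma>)"
    and \<alpha>: "\<alpha> \<in> graph_aut X" and \<sigma>: "\<sigma> \<in> Bij {0, 1}"
    by (auto simp: aut_times_S2_def)
  have app: "\<phi> (v, i) = (\<alpha> v, \<sigma> i)" if "v \<in> pverts X" "i \<in> {0, 1}" for v i
    using that by (simp add: \<phi> prod_act_def)
  have b\<alpha>: "bij_betw \<alpha> (pverts X) (pverts X)" and b\<sigma>: "bij_betw \<sigma> {0, 1} {0, 1}"
    using \<alpha> \<sigma> by (auto simp: graph_aut_def Bij_def)
  have "bij_betw (map_prod \<alpha> \<sigma>) (pverts X \<times> {0, 1}) (pverts X \<times> {0, 1})"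
    by (rule bij_betw_map_prod[OF b\<alpha> b\<sigma>])
  then have "bij_betw \<phi> (pverts X \<times> {0, 1}) (pverts X \<times> {0, 1})"
    by (rule bij_betw_cong[THEN iffD1, rotated]) (auto simp: app)
  moreover have "\<phi> \<in> extensional (pverts X \<times> {0, 1})"
    by (simp add: \<phi> prod_act_def)
  moreover have "(\<phi> p, \<phi> q) \<in> parcs (bip_double X) \<longleftrightarrow> (p, q) \<in> parcs (bip_double X)"
    if p: "p \<in> pverts X \<times> {0, 1}" and q: "q \<in> pverts X \<times> {0, 1}" for p q
  proof -
    obtain v i w j where pq: "p = (v, i)" "q = (w, j)" by fastforce
    have "\<sigma> i \<in> {0, 1}" "\<sigma> j \<in> {0, 1}" "\<sigma> i = \<sigma> j \<longleftrightarrow> i = j"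
      using b\<sigma> p q pq by (auto simp: bij_betw_def inj_on_def)
    moreover have "(\<alpha> v, \<alpha> w) \<in> parcs X \<longleftrightarrow> (v, w) \<in> parcs X"
      using \<alpha> p q pq by (auto simp: graph_aut_def)
    ultimately show ?thesis
      using p q unfolding pq by (auto simp: app parcs_bip_double_iff[OF X])
  qed
  ultimately show "\<phi> \<in> graph_aut (bip_double X)"
    by (simp add: graph_aut_def Bij_def)
qed

text \<open>Arcs of the double cover change sides, and so do their images; two consecutive arcs
  therefore return to the same side, which settles multiplication by squares of elements of
  \<open>S\<close>.\<close>

lemma (in comm_group) bip_double_Cay_side_const:
  assumes odd: "odd (order G)" and S: "S \<subseteq> carrier G"
    and X: "pair_sym_digraph (Cay G S)" and conn: "connected (with_proj (Cay G S))"
    and \<phi>: "\<phi> \<in> graph_aut (bip_double (Cay G S))"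
    and i: "i \<in> {0, 1}" and xy: "x \<in> carrier G" "y \<in> carrier G"
  shows "snd (\<phi> (x, i)) = snd (\<phi> (y, i))"
proof (rule connected_Cay_const[OF conn _ xy])
  fix s x assume s: "s \<in> S" and x: "x \<in> carrier G"
  have sc: "s \<in> carrier G" using s S by auto
  have adj: "snd (\<phi> p) \<in> {0, 1} \<and> snd (\<phi> q) \<in> {0, 1} \<and> snd (\<phi> p) \<noteq> snd (\<phi> q)"
    if "p \<in> carrier G \<times> {0, 1}" "q \<in> carrier G \<times> {0, 1}"
      "(p, q) \<in> parcs (bip_double (Cay G S))" for p q
  proof -
    have "(\<phi> p, \<phi> q) \<in> parcs (bip_double (Cay G S))"
      using that \<phi> unfolding graph_aut_def pverts_bip_double pverts_Cay by blast
    then show ?thesis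
      by (cases "\<phi> p"; cases "\<phi> q") (simp add: parcs_bip_double_iff[OF X])
  qed
  have two: "snd (\<phi> (s \<otimes> (s \<otimes> z), i)) = snd (\<phi> (z, i))" if z: "z \<in> carrier G" for z
  proof -
    \<comment> \<open>For \<open>i\<close> in \<open>{0, 1}\<close>, the natural number
      \<open>1 - i\<close> is the opposite side.\<close>
    have "((s \<otimes> z, 1 - i), (z, i)) \<in> parcs (bip_double (Cay G S))"
      "((s \<otimes> (s \<otimes> z), i), (s \<otimes> z, 1 - i)) \<in> parcs (bip_double (Cay G S))"
      using s sc z i by (auto simp: parcs_bip_double_iff[OF X] parcs_Cay_iff)
    then show ?thesis
      using adj[of "(s \<otimes> z, 1 - i)" "(z, i)"] adj[of "(s \<otimes> (s \<otimes> z), i)" "(s \<otimes> z, 1 - i)"] sc z i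
      by auto
  qed
  have even_power: "snd (\<phi> (s [^] (2 * k :: nat) \<otimes> x, i)) = snd (\<phi> (x, i))" for k
  proof (induction k)
    case (Suc k)
    have "s [^] (2 * Suc k) \<otimes> x = s \<otimes> (s \<otimes> (s [^] (2 * k) \<otimes> x))"
      using sc x by (simp add: m_ac)
    then show ?case using two[of "s [^] (2 * k) \<otimes> x"] Suc sc x by simp
  qed (use x in simp)
  \<comment> \<open>\<open>s\<close> equals its own power with the even exponent
    \<open>order G + 1\<close>, so multiplying by \<open>s\<close> amounts to multiplying repeatedly
    by its square.\<close>
  obtain k where "order G + 1 = 2 * k" using odd by (metis evenE odd_even_add odd_one)
  moreover have "s [^] (order G + 1) = s" using sc by (simp add: pow_order_eq_1)
  ultimately show "snd (\<phi> (s \<otimes> x, i)) = snd (\<phi> (x, i))" using even_power[of k] by simp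
qed

lemma (in comm_group) graph_aut_bip_double_Cay_subset:
  assumes fin: "finite (carrier G)" and odd: "odd (order G)" and S: "S \<subseteq> carrier G"
    and X: "pair_sym_digraph (Cay G S)" and conn: "connected (with_proj (Cay G S))"
    and tf: "twin_free (Cay G S)"
  shows "graph_aut (bip_double (Cay G S)) \<subseteq> aut_times_S2 (Cay G S)"
proof
  let ?V = "carrier G \<times> {0, 1 :: nat}"
  fix \<phi> assume \<phi>: "\<phi> \<in> graph_aut (bip_double (Cay G S))"
  then have bij: "bij_betw \<phi> ?V ?V" and ext: "\<phi> \<in> extensional ?V"
    by (auto simp: graph_aut_def Bij_def)
  \<comment> \<open>Sides are mapped into sides, so \<open>\<one>\<close> serves as a sample vertex.
    Restricting the function to \<open>{0, 1}\<close> gives the extensionality that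
    \<open>Bij\<close> demands.\<close>
  define \<sigma> where "\<sigma> = (\<lambda>i \<in> {0, 1}. snd (\<phi> (\<one>, i)))"
  define f where "f = (\<lambda>i. \<lambda>v \<in> carrier G. fst (\<phi> (v, i)))"
  have app: "\<phi> (v, i) = (f i v, \<sigma> i)" if "v \<in> carrier G" "i \<in> {0, 1}" for v i
    using that bip_double_Cay_side_const[OF odd S X conn \<phi> that(2) that(1) one_closed]
    by (auto simp: \<sigma>_def f_def prod_eq_iff)
  have im: "f i v \<in> carrier G" "\<sigma> i \<in> {0, 1}" if "v \<in> carrier G" "i \<in> {0, 1}" for v i
    using bij_betwE[OF bij] app[OF that] that by (metis mem_Sigma_iff)+
  \<comment> \<open>A preimage under \<open>\<phi>\<close> of a vertex on side \<open>j\<close> lies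
    on the required side \<open>i\<close>.\<close>
  have \<sigma>_surj: "\<exists>i \<in> {0, 1}. \<sigma> i = j" if j: "j \<in> {0, 1}" for j
  proof -
    have "(\<one>, j) \<in> \<phi> ` ?V" using bij j by (simp add: bij_betw_def)
    then obtain p where p: "(\<one>, j) = \<phi> p" "p \<in> ?V" by (rule imageE)
    then show ?thesis using app[of "fst p" "snd p"] by (auto simp: mem_Times_iff)
  qed
  have \<sigma>01: "\<sigma> ` {0, 1} = {0, 1}" 
  proof
    show "\<sigma> ` {0, 1} \<subseteq> {0, 1}" by (rule image_subsetI) (rule im(2)[OF one_closed])
    show "{0, 1} \<subseteq> \<sigma> ` {0, 1}" using \<sigma>_surj by (metis imageI subsetI)
  qed
  then have \<sigma>_inj: "inj_on \<sigma> {0, 1}" by (intro eq_card_imp_inj_on) simp_all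
  have \<sigma>: "\<sigma> \<in> Bij {0, 1}"
    using \<sigma>01 \<sigma>_inj by (auto simp: Bij_def bij_betw_def \<sigma>_def)
  \<comment> \<open>Injectivity is inherited from \<open>\<phi>\<close> because side
    \<open>i\<close> has a single image side; finiteness of the group then gives
    surjectivity.\<close>
  have fbij: "bij_betw (f i) (carrier G) (carrier G)" if i: "i \<in> {0, 1}" for i
  proof -
    have "inj_on (f i) (carrier G)"
    proof (rule inj_onI)
      fix v w assume vw: "v \<in> carrier G" "w \<in> carrier G" "f i v = f i w"
      then have "\<phi> (v, i) = \<phi> (w, i)" using app i by simp
      then show "v = w" using bij vw i unfolding bij_betw_def inj_on_def by blast
    qed
    moreover have "f i ` carrier G \<subseteq> carrier G" using im i by auto
    ultimately show ?thesis
      using fin by (simp add: bij_betw_def endo_inj_surj)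
  qed
  have fij: "(f i v, f j w) \<in> parcs (Cay G S) \<longleftrightarrow> (v, w) \<in> parcs (Cay G S)"
    if "v \<in> carrier G" "w \<in> carrier G" "i \<in> {0, 1}" "j \<in> {0, 1}" "i \<noteq> j" for v w i j
  proof -
    have "(\<phi> (v, i), \<phi> (w, j)) \<in> parcs (bip_double (Cay G S)) \<longleftrightarrow>
        ((v, i), (w, j)) \<in> parcs (bip_double (Cay G S))"
      using \<phi> that(1-4) unfolding graph_aut_def pverts_bip_double pverts_Cay by blast
    moreover have "\<sigma> i \<noteq> \<sigma> j" 
      using inj_on_eq_iff[OF \<sigma>_inj that(3,4)] that(5) by simp
    ultimately show ?thesis
      using that im(2)[OF that(1,3)] im(2)[OF that(2,4)]
      unfolding app[OF that(1,3)] app[OF that(2,4)] parcs_bip_double_iff[OF X] by blast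
  qed
  \<comment> \<open>The two mixed hypotheses on the side maps are \<open>fij\<close> for the sides
    (0, 1) and (1, 0).\<close>
  have eq: "\<forall>v \<in> carrier G. f 0 v = f 1 v"
    by (rule Cay_twin_free_side_maps_eq(1)[OF fin odd S tf]) (use fbij fij in simp_all)
  have aut: "\<forall>v \<in> carrier G. \<forall>w \<in> carrier G.
      (f 0 v, f 0 w) \<in> parcs (Cay G S) \<longleftrightarrow> (v, w) \<in> parcs (Cay G S)"
    by (rule Cay_twin_free_side_maps_eq(2)[OF fin odd S tf, of _ "f 1"]) (use fbij fij in simp_all)
  have "f 0 \<in> graph_aut (Cay G S)"
    using aut fbij by (simp add: graph_aut_def Bij_def f_def)
  moreover have "\<phi> = prod_act (pverts (Cay G S)) (f 0, \<sigma>)"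
  proof
    fix p :: "'a \<times> nat"
    obtain v i where p: "p = (v, i)" by fastforce
    show "\<phi> p = prod_act (pverts (Cay G S)) (f 0, \<sigma>) p"
    proof (cases "p \<in> ?V")
      case True
      then have "f i v = f 0 v" using eq p by auto
      then show ?thesis using True app p by (simp add: prod_act_def)
    next
      \<comment> \<open>Outside the vertex set both maps are \<open>undefined\<close>.\<close>
      case False
      then show ?thesis using extensional_arb[OF ext] by (simp add: prod_act_def)
    qed
  qed
  ultimately show "\<phi> \<in> aut_times_S2 (Cay G S)"
    using \<sigma> by (auto simp: aut_times_S2_def)
qed

theorem theorem1p1:
  fixes G :: "('a, 'm) monoid_scheme" and S :: "'a set" and X :: "'a pair_pre_digraph"
  assumes "comm_group G" and "finite (carrier G)" and "odd (order G)"
    and "S \<subseteq> carrier G" and "\<And>s. s \<in> S \<Longrightarrow> inv\<^bsub>G\<^esub> s \<in> S"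
    and "X = Cay G S"
    and "connected (with_proj X)" and "twin_free X"
  shows "graph_aut (bip_double X) = aut_times_S2 X"
proof -
  interpret comm_group G by fact
  have X: "pair_sym_digraph (Cay G S)"
    by (rule pair_sym_digraph_Cay) (use assms in auto)
  show ?thesis
    using graph_aut_bip_double_Cay_subset[OF assms(2-4) X] aut_times_S2_subset[OF X] assms(6-8)
    by blast
qed

end
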